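(* Let $s=2$, let $p,q$ be integers with $3\le p\le q$, and let $n=p+q+1$. Let $K_p=(k_{i,j})$ be the $p\times p$ matrix over $\mathrm{GF}(2)$ with $k_{i,j}=1$ if $i\le j$ and $k_{i,j}=0$ if $i>j$, and let $L_p=I_p+K_p(I_p+J_p)$. Then the following $(p+q)\times n$ matrix over $\mathrm{GF}(2)$, whose first $p$ rows form $\mathcal{G}_c$ and whose last $q$ rows form $\mathcal{G}_r$, yields a 2fi-optimal $2^{n-1}$ fractional factorial row-column design (in a $2^p\times2^q$ array): $$\mathcal{G}=\left(\begin{array}{cccc} I_p & I_p+J_p & \boldsymbol{1}_p & X_*\\ \hline K_p & L_p & K_p\boldsymbol{1}_p+\boldsymbol{1}_p & \boldsymbol{0}_{p\times(q-p)}\\ \boldsymbol{0}_{(q-p)\times p} & \boldsymbol{0}_{(q-p)\times p} & \boldsymbol{0}_{(q-p)\times1} & I_{q-p}\end{array}\right),$$ where $X_*$ is a $p\times(q-p)$ matrix, with no zero column, selected so that each point of $\mathrm{PG}(p-1,2)$ appears among the columns of the $p\times n$ matrix $(I_p\;\;I_p+J_p\;\;\boldsymbol{1}_p\;\;X_* )$ either $\alpha$ or $\alpha+1$ times, where $\alpha=\lfloor n/(2^p-1)\rfloor$.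
   Context: Matrices. $s$ is a prime (here $s=2$) and all matrices have entries in $\mathrm{GF}(s)=\mathbb{Z}/s$ (integers are reduced mod $s$). $I_v$ is the $v\times v$ identity, $J_v$ the $v\times v$ all-ones matrix, $\boldsymbol{1}_v$ the $v\times1$ all-ones vector, $\boldsymbol{0}_{v\times w}$ the zero matrix. Blocks with zero rows or columns are omitted. $\mathrm{PG}(m-1,s)$ is the set of 1-dimensional subspaces ("points") of $\mathrm{GF}(s)^m$; a nonzero column vector belongs to (is an appearance of) the point it spans. Designs. Let $p,q\ge1$, $p+q\le n$. An array generator matrix is a $(p+q)\times n$ matrix $\mathcal{G}$ over $\mathrm{GF}(s)$ of full row rank $p+q$; $\mathcal{G}_c$ denotes its first $p$ rows, $\mathcal{G}_r$ its last $q$ rows, and $\mathcal{G}_i,\mathcal{G}_{c,i},\mathcal{G}_{r,i}$ the $i$-th columns of $\mathcal{G},\mathcal{G}_c,\mathcal{G}_r$. If $\boldsymbol{x}_1,\dots,\boldsymbol{x}_{s^p}$ are the vectors of the row space of $\mathcal{G}_c$ and $\boldsymbol{y}_1,\dots,\boldsymbol{y}_{s^q}$ those of the row space of $\mathcal{G}_r$ (with $\boldsymbol{x}_1=\boldsymbol{y}_1=0$), $\mathcal{G}$ yields the $s^p\times s^q$ row-column design whose cell $(i,j)$ carries the level combination $d[i,j]=\boldsymbol{x}_i+\boldsymbol{y}_j\in\mathrm{GF}(s)^n$ of the $n$ factors $F_1,\dots,F_n$. It is an $s^n$ full factorial design when $p+q=n$, and an $s^{n-k}$ fractional factorial design when $p+q=n-k<n$.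 Model and confounding. $Y_{ij}=\mu+\tau_i+\rho_j+\gamma_{d[i,j]}+\varepsilon_{ij}$, with row effects $\tau_i$, column effects $\rho_j$, uncorrelated mean-zero errors of variance $\sigma^2$, and $\gamma_{(x_1,\dots,x_n)}=\sum_l\alpha_{l,x_l}+\sum_{l<m}\sum_{v=1}^{s-1}\beta^{(v)}_{lm,\,x_l+vx_m}$, where $\sum_u\alpha_{l,u}=0$ and $\sum_u\beta^{(v)}_{lm,u}=0$. A main effect $F_l$ is unconfounded if the estimators of the $\alpha_{l,u}$ are uncorrelated with all other estimators in the model; the two-factor interaction (2fi) $F_l\times F_m$ is unconfounded if for every $v=1,\dots,s-1$ the estimators of the $\beta^{(v)}_{lm,u}$ are uncorrelated with all other estimators in the model. Interactions of three or more factors are assumed negligible. Equivalent algebraic criterion (known result, Zhou and Zhou 2023), usable as the definition of confounding. A main effect or 2fi is confounded with another main effect or 2fi iff the columns of $\mathcal{G}$ corresponding to the (distinct) factors involved in the two effects are linearly dependent. If $\mathcal{G}_i\ne0$, $F_i$ is confounded with column effects iff $\mathcal{G}_{c,i}=0$, and with row effects iff $\mathcal{G}_{r,i}=0$. If $\mathcal{G}_i,\mathcal{G}_j$ are linearly independent, $F_i\times F_j$ is confounded with column effects iff $\mathcal{G}_{c,i},\mathcal{G}_{c,j}$ are linearly dependent, and with row effects iff $\mathcal{G}_{r,i},\mathcal{G}_{r,j}$ are linearly dependent. An effect is unconfounded iff none of these confoundings occurs. 2fi-optimality. The design yielded by $\mathcal{G}$ is 2fi-optimal if all main effects are unconfounded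 and the number of unconfounded 2fi's is maximum among all designs yielded by array generator matrices with the same $(s,p,q,n)$ for which all main effects are unconfounded. *)

theory Defs
  imports "Jordan_Normal_Form.DL_Rank" "HOL-Library.Z2"
begin

text \<open>
  The designs live over GF(s), s prime; the general notions are stated over an arbitrary field
  type \<open>'a\<close>, which fixes s, and the theorem uses \<^typ>\<open>bit\<close> for GF(2). Factors, rows and columns
  are numbered from 0.
\<close>

subsection \<open>Block matrices and linear dependence\<close>

definition append_cols :: "'a::zero mat \<Rightarrow> 'a mat \<Rightarrow> 'a mat" (infixr \<open>@\<^sub>c\<close> 66) where
  "A @\<^sub>c B = four_block_mat A B (0\<^sub>m 0 (dim_col A)) (0\<^sub>m 0 (dim_col B))"

definition const_mat :: "nat \<Rightarrow> nat \<Rightarrow> 'a \<Rightarrow> 'a mat" where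
  "const_mat m n a = mat m n (\<lambda>_. a)"

text \<open>
  Linear dependence of the columns of \<open>A\<close> with indices in \<open>S\<close>, as an indexed family: two equal
  columns with different indices are dependent. (Dependence of the set \<open>col A ` S\<close> would
  identify them.)
\<close>

definition cols_dependent :: "'a::field mat \<Rightarrow> nat set \<Rightarrow> bool" where
  "cols_dependent A S \<longleftrightarrow>
     (\<exists>a. (\<exists>i\<in>S. a i \<noteq> 0) \<and> (\<forall>r<dim_row A. (\<Sum>i\<in>S. a i * A $$ (r, i)) = 0))"

subsection \<open>Array generator matrices\<close>

definition array_generator :: "nat \<Rightarrow> nat \<Rightarrow> nat \<Rightarrow> 'a::field mat \<Rightarrow> bool" where
  "array_generator p q n G \<longleftrightarrow>
     1 \<le> p \<and> 1 \<le> q \<and> p + q \<le> n \<and>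
     G \<in> carrier_mat (p + q) n \<and> vec_space.rank (p + q) G = p + q"

text \<open>The design is an \<open>s^(n-k)\<close> fractional factorial design in an \<open>s^p \<times> s^q\<close> array.\<close>

definition fractional_factorial_generator ::
    "nat \<Rightarrow> nat \<Rightarrow> nat \<Rightarrow> nat \<Rightarrow> 'a::field mat \<Rightarrow> bool" where
  "fractional_factorial_generator p q n k G \<longleftrightarrow>
     array_generator p q n G \<and> 1 \<le> k \<and> p + q + k = n"

definition gen_c :: "nat \<Rightarrow> 'a mat \<Rightarrow> 'a mat" where
  "gen_c p G = mat p (dim_col G) (\<lambda>(i, j). G $$ (i, j))"

definition gen_r :: "nat \<Rightarrow> 'a mat \<Rightarrow> 'a mat" where
  "gen_r p G = mat (dim_row G - p) (dim_col G) (\<lambda>(i, j). G $$ (p + i, j))"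

subsection \<open>Confounding\<close>

text \<open>
  An effect is represented by the set of the factors it involves: \<open>{l}\<close> is the main effect of
  factor \<open>l\<close>, and \<open>{l, m}\<close> is the two-factor interaction of \<open>l\<close> and \<open>m\<close>. Confounding is defined
  by the algebraic criterion of Zhou and Zhou (2023).
\<close>

definition main_effects :: "nat \<Rightarrow> nat set set" where
  "main_effects n = {{l} | l. l < n}"

definition two_factor_interactions :: "nat \<Rightarrow> nat set set" where
  "two_factor_interactions n = {{l, m} | l m. l < m \<and> m < n}"

definition confounded_effects :: "'a::field mat \<Rightarrow> nat set \<Rightarrow> nat set \<Rightarrow> bool" where
  "confounded_effects G E E' \<longleftrightarrow> cols_dependent G (E \<union> E')"

text \<open>
  For a main effect the next two conditions say that the single column is zero. The criterion is
  restricted to effects whose columns in \<open>G\<close> are linearly independent; all other effects are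
  already confounded with a main effect or two-factor interaction (as \<open>n \<ge> 2\<close>), so that they
  may be left unrestricted here.
\<close>

definition confounded_with_columns :: "nat \<Rightarrow> 'a::field mat \<Rightarrow> nat set \<Rightarrow> bool" where
  "confounded_with_columns p G E \<longleftrightarrow> cols_dependent (gen_c p G) E"

definition confounded_with_rows :: "nat \<Rightarrow> 'a::field mat \<Rightarrow> nat set \<Rightarrow> bool" where
  "confounded_with_rows p G E \<longleftrightarrow> cols_dependent (gen_r p G) E"

definition unconfounded :: "nat \<Rightarrow> 'a::field mat \<Rightarrow> nat set \<Rightarrow> bool" where
  "unconfounded p G E \<longleftrightarrow>
     (\<forall>E' \<in> main_effects (dim_col G) \<union> two_factor_interactions (dim_col G).
        E' \<noteq> E \<longrightarrow> \<not> confounded_effects G E E') \<and>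
     \<not> confounded_with_columns p G E \<and> \<not> confounded_with_rows p G E"

subsection \<open>2fi-optimality\<close>

definition main_effects_unconfounded :: "nat \<Rightarrow> 'a::field mat \<Rightarrow> bool" where
  "main_effects_unconfounded p G \<longleftrightarrow> (\<forall>E \<in> main_effects (dim_col G). unconfounded p G E)"

definition num_unconfounded_2fi :: "nat \<Rightarrow> 'a::field mat \<Rightarrow> nat" where
  "num_unconfounded_2fi p G = card {E \<in> two_factor_interactions (dim_col G). unconfounded p G E}"

definition two_fi_optimal :: "nat \<Rightarrow> nat \<Rightarrow> nat \<Rightarrow> 'a::field mat \<Rightarrow> bool" where
  "two_fi_optimal p q n G \<longleftrightarrow>
     array_generator p q n G \<and> main_effects_unconfounded p G \<and>
     (\<forall>H :: 'a mat. array_generator p q n H \<and> main_effects_unconfounded p H \<longrightarrow>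
        num_unconfounded_2fi p H \<le> num_unconfounded_2fi p G)"

subsection \<open>Points of projective space\<close>

text \<open>
  \<open>PG_points m\<close> is the point set of PG(m-1, s): the one-dimensional subspaces of \<open>GF(s)^m\<close>,
  each including the zero vector.
\<close>

definition PG_points :: "nat \<Rightarrow> 'a::field vec set set" where
  "PG_points m = {range (\<lambda>a. a \<cdot>\<^sub>v v) | v. v \<in> carrier_vec m \<and> v \<noteq> 0\<^sub>v m}"

definition appearances :: "'a::field mat \<Rightarrow> 'a vec set \<Rightarrow> nat" where
  "appearances A P = card {j. j < dim_col A \<and> col A j \<noteq> 0\<^sub>v (dim_row A) \<and> col A j \<in> P}"

subsection \<open>The construction\<close>

abbreviation J_mat :: "nat \<Rightarrow> bit mat" where
  "J_mat v \<equiv> const_mat v v 1"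

text \<open>The all-ones vector as a one-column matrix.\<close>

abbreviation ones_col :: "nat \<Rightarrow> bit mat" where
  "ones_col v \<equiv> const_mat v 1 1"

definition K_mat :: "nat \<Rightarrow> bit mat" where
  "K_mat p = mat p p (\<lambda>(i, j). if i \<le> j then 1 else 0)"

definition L_mat :: "nat \<Rightarrow> bit mat" where
  "L_mat p = 1\<^sub>m p + K_mat p * (1\<^sub>m p + J_mat p)"

definition G_upper :: "nat \<Rightarrow> bit mat \<Rightarrow> bit mat" where
  "G_upper p X = 1\<^sub>m p @\<^sub>c (1\<^sub>m p + J_mat p) @\<^sub>c ones_col p @\<^sub>c X"

definition G_lower :: "nat \<Rightarrow> nat \<Rightarrow> bit mat" where
  "G_lower p q =
     (K_mat p @\<^sub>c L_mat p @\<^sub>c (K_mat p * ones_col p + ones_col p) @\<^sub>c 0\<^sub>m p (q - p)) @\<^sub>r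
     (0\<^sub>m (q - p) p @\<^sub>c 0\<^sub>m (q - p) p @\<^sub>c 0\<^sub>m (q - p) 1 @\<^sub>c 1\<^sub>m (q - p))"

definition G_mat :: "nat \<Rightarrow> nat \<Rightarrow> bit mat \<Rightarrow> bit mat" where
  "G_mat p q X = G_upper p X @\<^sub>r G_lower p q"

end

theory Submission imports Defs
begin

text \<open>
  If all main effects of a generator \<open>H\<close> are unconfounded, then no column of its upper block is
  zero, and a two-factor interaction can be unconfounded only if its two upper columns differ:
  equal columns would confound it with column effects. So the number of unconfounded two-factor
  interactions is at most the number of pairs of factors whose upper columns differ. The factors
  fall into classes of equal upper columns, and the number of such pairs is \<open>(n\<^sup>2 - \<Sum>m\<^sub>v\<^sup>2) / 2\<close>,
  where \<open>m\<^sub>v\<close> is the size of the class of the nonzero vector \<open>v\<close>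
  (\<open>card_separated_2fi\<close>). For a fixed total \<open>n\<close>, convexity makes the sum of squares least when
  all \<open>m\<^sub>v\<close> lie in \<open>{\<alpha>, \<alpha> + 1}\<close> (\<open>balanced_sum_squares_le\<close>), and this is what is required of
  \<open>X\<close>. Over GF(2) a point of the projective space is just a nonzero vector.
  
  It remains to see that the constructed generator attains the bound, that is, nothing else
  confounds an effect. There are two possible sources.
  
  \<^item> Row effects: the columns of the lower block are nonzero and pairwise distinct
    (\<open>col_G_lower_nonzero\<close>, \<open>inj_on_col_G_lower\<close>). Write \<open>k\<^sub>t\<close> for the vector with \<open>t\<close> leading
    ones and \<open>u = K\<^sub>p 1\<^sub>p\<close>. The columns over \<open>K\<^sub>p\<close> are \<open>k\<^sub>1, \<dots>, k\<^sub>p\<close>, and the next \<open>p + 1\<close> are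
    \<open>u + k\<^sub>0, \<dots>, u + k\<^sub>p\<close>. A coincidence would make \<open>u\<close> a sum of two \<open>k\<^sub>t\<close>, hence a vector whose
    ones are contiguous; but \<open>u\<close> alternates and, as \<open>p \<ge> 3\<close>, ends in \<open>1, 0, 1\<close>. The columns after
    these are the unit vectors of the last \<open>q - p\<close> rows, where all others vanish.
  
  \<^item> Other effects: two effects involve at most four factors, and any four columns of the
    generator are independent (\<open>small_sets_independent_G_mat\<close>). On the first \<open>2 p + 1\<close> columns the
    lower block is \<open>K\<^sub>p\<close> times the upper one, plus the block \<open>(0 I\<^sub>p 1\<^sub>p)\<close>. So a linear relation
    among the columns also satisfies the equations given by \<open>(0 I\<^sub>p 1\<^sub>p)\<close>, which force the
    coefficients at positions \<open>p, \<dots>, 2 p\<close> to be equal; the upper block then determines the others.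
    The only nontrivial relation has support \<open>{p..2 p}\<close> if \<open>p\<close> is even and \<open>{0..2 p}\<close> if \<open>p\<close> is
    odd, in either case at least five columns (\<open>dependent_cols_G_mat\<close>). Since it involves column
    \<open>2 p\<close>, the other \<open>p + q\<close> columns are independent, and the rank is full.
\<close>

section \<open>Arithmetic in GF(2)\<close>

text \<open>
  These simplification rules turn sums and products in GF(2) into bitwise operations, on which the
  laws of fields and of finite sums no longer act.
\<close>

declare add_bit_eq_xor [simp del] mult_bit_eq_and [simp del]

lemma bit_add_self: "x + x = (0::bit)"
  by (cases x) simp_all

lemma bit_add_eq_0_iff: "x + y = 0 \<longleftrightarrow> x = (y::bit)"
  by (cases x; cases y) (simp_all add: bit_add_self)

lemma of_nat_bit: "(of_nat k :: bit) = of_bool (odd k)"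
  by (induction k) (simp_all add: bit_add_self)

section \<open>Linear dependence of columns\<close>

lemma not_inj_imp_cols_dependent:
  fixes A :: "'a::field mat"
  assumes "finite S" "S \<subseteq> {..<dim_col A}" "\<not> inj_on (col A) S"
  shows "cols_dependent A S"
proof -
  obtain i j where ij: "i \<in> S" "j \<in> S" "i \<noteq> j" "col A i = col A j"
    using assms(3) unfolding inj_on_def by blast
  define a where "a = (\<lambda>k. if k = i then 1 else if k = j then -1 else (0::'a))"
  have "(\<Sum>k\<in>S. a k * A $$ (r, k)) = 0" if r: "r < dim_row A" for r
  proof -
    have "(\<Sum>k\<in>S. a k * A $$ (r, k)) = (\<Sum>k\<in>{i, j}. a k * A $$ (r, k))"
      by (rule sum.mono_neutral_right) (use assms(1) ij in \<open>auto simp: a_def\<close>)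
    also have "\<dots> = A $$ (r, i) - A $$ (r, j)"
      using ij by (simp add: a_def)
    also have "\<dots> = col A i $ r - col A j $ r"
      using ij(1,2) assms(2) r by (subst (1 2) index_col) auto
    finally show ?thesis
      using ij(4) by simp
  qed
  moreover have "a i \<noteq> 0"
    by (simp add: a_def)
  ultimately show ?thesis
    unfolding cols_dependent_def using ij(1) by blast
qed

lemma zero_col_imp_cols_dependent:
  fixes A :: "'a::field mat"
  assumes "j < dim_col A" "col A j = 0\<^sub>v (dim_row A)"
  shows "cols_dependent A {j}"
proof -
  have "A $$ (r, j) = 0" if "r < dim_row A" for r
    using arg_cong[OF assms(2), of "\<lambda>v. v $ r"] that assms(1) by simp
  then show ?thesis
    unfolding cols_dependent_def by (intro exI[of _ "\<lambda>_. 1"]) simp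
qed

text \<open>
  The only nonzero scalar of GF(2) is 1, so two nonzero columns can be dependent only by being equal
  columns at different positions.
\<close>

lemma dependent_pair_bit:
  fixes A :: "bit mat"
  assumes dep: "cols_dependent A {i, j}" and lt: "i < dim_col A" "j < dim_col A"
    and nz: "col A i \<noteq> 0\<^sub>v (dim_row A)" "col A j \<noteq> 0\<^sub>v (dim_row A)"
  shows "i \<noteq> j \<and> col A i = col A j"
proof -
  obtain a where a: "a i \<noteq> 0 \<or> a j \<noteq> 0"
    and sum0: "\<And>r. r < dim_row A \<Longrightarrow> (\<Sum>k\<in>{i, j}. a k * A $$ (r, k)) = 0"
    using dep unfolding cols_dependent_def by auto
  have ex: "\<exists>r<dim_row A. A $$ (r, k) = 1" if "k < dim_col A" "col A k \<noteq> 0\<^sub>v (dim_row A)" for k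
  proof (rule ccontr)
    assume "\<not> ?thesis"
    then have "col A k = 0\<^sub>v (dim_row A)"
      using that(1) by (intro eq_vecI) auto
    with that(2) show False ..
  qed
  obtain r s where r: "r < dim_row A" "A $$ (r, i) = 1" and s: "s < dim_row A" "A $$ (s, j) = 1"
    using ex[OF lt(1) nz(1)] ex[OF lt(2) nz(2)] by blast
  have ne: "i \<noteq> j"
  proof
    assume "i = j"
    then show False using sum0[OF r(1)] r(2) a by simp
  qed
  have eq0: "a i * A $$ (t, i) + a j * A $$ (t, j) = 0" if "t < dim_row A" for t
    using sum0[OF that] ne by simp
  have ai: "a i = 1"
    using a eq0[OF s(1)] s(2) by (cases "a i") auto
  have aj: "a j = 1"
    using a eq0[OF r(1)] r(2) by (cases "a j") auto
  have "col A i = col A j"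
    using eq0 lt by (intro eq_vecI) (auto simp: ai aj bit_add_eq_0_iff)
  with ne show ?thesis ..
qed

text \<open>
  Links dependence of an indexed family of columns with the rank, which is defined through the set
  of columns: an independent family has no repeated column, so nothing is lost in passing to the
  set.
\<close>

lemma (in vec_space) card_le_rank_if_cols_independent:
  assumes A: "A \<in> carrier_mat n nc" and J: "J \<subseteq> {..<nc}" and ind: "\<not> cols_dependent A J"
  shows "card J \<le> rank A"
proof -
  have fin: "finite J"
    using J finite_subset by blast
  have inj: "inj_on (col A) J"
    using not_inj_imp_cols_dependent[OF fin] J A ind by auto
  have sub: "col A ` J \<subseteq> set (cols A)"
    using J A by (auto simp: cols_def)
  have car: "col A ` J \<subseteq> carrier_vec n"
    using A by auto
  have "lin_indpt (col A ` J)"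
  proof
    assume "lin_dep (col A ` J)"
    then obtain a v where lc: "lincomb a (col A ` J) = 0\<^sub>v n" and v: "v \<in> col A ` J" "a v \<noteq> 0"
      using finite_lin_dep[of "col A ` J"] fin car by auto
    have "(\<Sum>j\<in>J. a (col A j) * A $$ (r, j)) = 0" if r: "r < n" for r
    proof -
      have "(\<Sum>j\<in>J. a (col A j) * A $$ (r, j)) = (\<Sum>j\<in>J. a (col A j) * col A j $ r)"
        using J A r by (intro sum.cong refl) (subst index_col, auto)
      also have "\<dots> = (\<Sum>x\<in>col A ` J. a x * x $ r)"
        by (simp add: sum.reindex[OF inj])
      also have "\<dots> = lincomb a (col A ` J) $ r"
        by (rule lincomb_index[OF r car, symmetric])
      finally show ?thesis
        using lc r by simp
    qed
    then have "cols_dependent A J"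
      unfolding cols_dependent_def using v A by (intro exI[of _ "\<lambda>j. a (col A j)"]) auto
    with ind show False ..
  qed
  from rank_ge_card_indpt[OF A sub this] show ?thesis
    by (simp add: card_image[OF inj])
qed

lemma (in vec_space) rank_le_nr:
  assumes A: "A \<in> carrier_mat n nc"
  shows "rank A \<le> n"
proof -
  obtain S where S: "maximal S (\<lambda>T. T \<subseteq> set (cols A) \<and> lin_indpt T)"
    using maximal_exists_superset[of "set (cols A)" "\<lambda>T. T \<subseteq> set (cols A) \<and> lin_indpt T" "{}"]
    by (auto simp: lin_dep_def)
  then have "S \<subseteq> carrier_vec n" "lin_indpt S"
    using cols_dim[of A] A unfolding maximal_def by auto
  then have "card S \<le> n"
    using li_le_dim(2)[of S] dim_is_n by auto
  then show ?thesis
    using rank_card_indpt[OF A S] by simp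
qed

section \<open>Counting pairs of factors with different upper columns\<close>

text \<open>
  All \<open>n\<^sup>2\<close> ordered pairs are counted: a pair \<open>{i, j}\<close> separated by \<open>f\<close> gives two, and the pairs with
  \<open>f i = f j\<close>, including \<open>i = j\<close>, form the squares of the fibres of \<open>f\<close>.
\<close>

lemma card_separated_2fi:
  fixes f :: "nat \<Rightarrow> 'b"
  assumes V: "finite V" "f ` {..<n} \<subseteq> V"
  shows "2 * card {E \<in> two_factor_interactions n. inj_on f E} +
    (\<Sum>v\<in>V. (card {j. j < n \<and> f j = v})\<^sup>2) = n\<^sup>2"
proof -
  define D where "D = {(i, j). i < j \<and> j < n \<and> f i \<noteq> f j}"
  define F where "F = (\<lambda>v. {j. j < n \<and> f j = v})"
  have finD: "finite D"
    by (rule finite_subset[of _ "{..<n} \<times> {..<n}"]) (auto simp: D_def)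
  have "{E \<in> two_factor_interactions n. inj_on f E} = (\<lambda>(i, j). {i, j}) ` D"
    unfolding two_factor_interactions_def D_def by (auto simp: inj_on_def image_iff)
  moreover have "inj_on (\<lambda>(i, j). {i, j}) D"
    by (auto simp: inj_on_def D_def doubleton_eq_iff)
  ultimately have cD: "card {E \<in> two_factor_interactions n. inj_on f E} = card D"
    by (simp add: card_image)
  have cD': "card (prod.swap ` D) = card D"
    by (simp add: card_image)
  have cF: "card (\<Union>v\<in>V. F v \<times> F v) = (\<Sum>v\<in>V. (card (F v))\<^sup>2)"
    by (subst card_UN_disjoint)
      (use V in \<open>auto simp: F_def card_cartesian_product power2_eq_square\<close>)
  have "{..<n} \<times> {..<n} = (D \<union> prod.swap ` D) \<union> (\<Union>v\<in>V. F v \<times> F v)"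
  proof (intro equalityI subsetI)
    fix x assume "x \<in> {..<n} \<times> {..<n}"
    then obtain i j where x: "x = (i, j)" "i < n" "j < n" by blast
    consider "f i = f j" | "f i \<noteq> f j" "i < j" | "f i \<noteq> f j" "j < i"
      by (metis linorder_neqE_nat)
    then show "x \<in> (D \<union> prod.swap ` D) \<union> (\<Union>v\<in>V. F v \<times> F v)"
      by cases (use x V in \<open>auto simp: D_def F_def image_iff\<close>)
  qed (auto simp: D_def F_def)
  then have "n\<^sup>2 = card ((D \<union> prod.swap ` D) \<union> (\<Union>v\<in>V. F v \<times> F v))"
    by (metis card_cartesian_product card_lessThan power2_eq_square)
  also have "\<dots> = card (D \<union> prod.swap ` D) + card (\<Union>v\<in>V. F v \<times> F v)"
    by (rule card_Un_disjoint) (use finD V in \<open>auto simp: D_def F_def\<close>)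
  also have "card (D \<union> prod.swap ` D) = card D + card D"
    by (subst card_Un_disjoint) (use finD in \<open>auto simp: cD'\<close>, auto simp: D_def)
  finally have "n\<^sup>2 = 2 * card D + (\<Sum>v\<in>V. (card (F v))\<^sup>2)"
    by (simp add: cF)
  then show ?thesis
    unfolding cD by (simp add: F_def)
qed

text \<open>
  For an integer \<open>k\<close> the product \<open>(k - \<alpha>) (k - \<alpha> - 1)\<close> is nonnegative, and it vanishes exactly for
  \<open>k \<in> {\<alpha>, \<alpha> + 1}\<close>. So \<open>k\<^sup>2\<close> is bounded below by an affine function of \<open>k\<close> that it meets at these two
  values, and the sum of an affine function depends only on the total.
\<close>

lemma balanced_sum_squares_le:
  fixes m m' :: "'v \<Rightarrow> nat"
  assumes sum: "sum m V = sum m' V" and bal: "\<And>v. v \<in> V \<Longrightarrow> m' v \<in> {\<alpha>, \<alpha> + 1}"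
  shows "(\<Sum>v\<in>V. (m' v)\<^sup>2) \<le> (\<Sum>v\<in>V. (m v)\<^sup>2)"
proof -
  let ?c = "2 * int \<alpha> + 1" and ?d = "int \<alpha> * (int \<alpha> + 1)"
  have le: "?c * int k - ?d \<le> (int k)\<^sup>2" for k
  proof -
    have "0 \<le> (int k - int \<alpha>) * (int k - (int \<alpha> + 1))"
      by (cases "k \<le> \<alpha>") (auto intro: mult_nonneg_nonneg mult_nonpos_nonpos)
    then show ?thesis by (simp add: algebra_simps power2_eq_square)
  qed
  have "int (\<Sum>v\<in>V. (m' v)\<^sup>2) = (\<Sum>v\<in>V. ?c * int (m' v) - ?d)"
    unfolding of_nat_sum of_nat_power
    by (intro sum.cong refl) (use bal in \<open>force simp: algebra_simps power2_eq_square\<close>)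
  also have "\<dots> = ?c * int (sum m' V) - of_nat (card V) * ?d"
    by (simp add: sum_subtractf sum_distrib_left)
  also have "\<dots> = (\<Sum>v\<in>V. ?c * int (m v) - ?d)"
    by (simp add: sum_subtractf sum_distrib_left flip: sum)
  also have "\<dots> \<le> int (\<Sum>v\<in>V. (m v)\<^sup>2)"
    unfolding of_nat_sum of_nat_power by (intro sum_mono le)
  finally show ?thesis by linarith
qed

section \<open>Entries of the construction\<close>

lemma index_append_cols:
  assumes "i < dim_row A" "j < dim_col A + dim_col B"
  shows "(A @\<^sub>c B) $$ (i, j) = (if j < dim_col A then A $$ (i, j) else B $$ (i, j - dim_col A))"
  using assms unfolding append_cols_def by simp

lemma dim_append_cols [simp]:
  "dim_row (A @\<^sub>c B) = dim_row A" "dim_col (A @\<^sub>c B) = dim_col A + dim_col B"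
  by (simp_all add: append_cols_def)

lemma index_append_rows:
  assumes "i < dim_row A + dim_row B" "j < dim_col A"
  shows "(A @\<^sub>r B) $$ (i, j) = (if i < dim_row A then A $$ (i, j) else B $$ (i - dim_row A, j))"
  using assms unfolding append_rows_def by simp

lemma dim_append_rows [simp]:
  "dim_row (A @\<^sub>r B) = dim_row A + dim_row B" "dim_col (A @\<^sub>r B) = dim_col A"
  by (simp_all add: append_rows_def)

lemma dim_const_mat [simp]: "dim_row (const_mat m k a) = m" "dim_col (const_mat m k a) = k"
  by (simp_all add: const_mat_def)

lemma index_const_mat [simp]: "i < m \<Longrightarrow> j < k \<Longrightarrow> const_mat m k a $$ (i, j) = a"
  by (simp add: const_mat_def)

lemma dim_K_mat [simp]: "dim_row (K_mat p) = p" "dim_col (K_mat p) = p"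
  by (simp_all add: K_mat_def)

lemma dim_L_mat [simp]: "dim_row (L_mat p) = p" "dim_col (L_mat p) = p"
  by (simp_all add: L_mat_def)

lemma index_K_mat: "r < p \<Longrightarrow> j < p \<Longrightarrow> K_mat p $$ (r, j) = of_bool (r \<le> j)"
  by (simp add: K_mat_def)

text \<open>
  Multiplication by \<open>K\<^sub>p\<close> replaces each row by the sum of that row and all rows below it.
\<close>

lemma index_K_mult:
  assumes "r < p" "j < dim_col B" "dim_row B = p"
  shows "(K_mat p * B) $$ (r, j) = (\<Sum>i\<in>{r..<p}. B $$ (i, j))"
proof -
  have "(K_mat p * B) $$ (r, j) = (\<Sum>i\<in>{0..<p}. K_mat p $$ (r, i) * B $$ (i, j))"
    using assms by (simp add: scalar_prod_def)
  also have "\<dots> = (\<Sum>i\<in>{0..<p}. if r \<le> i then B $$ (i, j) else 0)"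
    using assms(1) by (intro sum.cong refl) (simp add: index_K_mat)
  also have "\<dots> = (\<Sum>i\<in>{r..<p}. B $$ (i, j))"
    by (intro sum.mono_neutral_cong_right) auto
  finally show ?thesis .
qed

lemma dim_G_upper [simp]:
  assumes "X \<in> carrier_mat p k"
  shows "dim_row (G_upper p X) = p" "dim_col (G_upper p X) = 2 * p + 1 + k"
  using assms by (simp_all add: G_upper_def)

lemma dim_G_lower [simp]:
  "dim_row (G_lower p q) = p + (q - p)" "dim_col (G_lower p q) = 2 * p + 1 + (q - p)"
  by (simp_all add: G_lower_def)

text \<open>
  The block \<open>I\<^sub>p + J\<^sub>p\<close> and the column \<open>1\<^sub>p\<close> share one formula, because for \<open>j = 2 p\<close> the row index \<open>r\<close>
  never equals \<open>j - p = p\<close>.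
\<close>

lemma index_G_upper:
  assumes "X \<in> carrier_mat p k" "r < p" "j < 2 * p + 1 + k"
  shows "G_upper p X $$ (r, j) =
    (if j < p then of_bool (r = j) else if j \<le> 2 * p then of_bool (r \<noteq> j - p)
     else X $$ (r, j - (2 * p + 1)))"
  using assms unfolding G_upper_def
  by (auto simp: index_append_cols bit_add_self mult_2)

text \<open>
  The entry \<open>of_nat (p - r)\<close> is that of \<open>u = K\<^sub>p 1\<^sub>p\<close>. Since \<open>K\<^sub>p (I\<^sub>p + J\<^sub>p)\<close> has the entries
  \<open>of_nat (p - r) + of_bool (r \<le> t)\<close>, adding \<open>I\<^sub>p\<close> turns \<open>r \<le> t\<close> into \<open>r < t\<close>. The column
  \<open>u + 1\<^sub>p\<close> is the case \<open>t = p\<close> of the same formula.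
\<close>

lemma index_G_lower_top:
  assumes "r < p" "j < 2 * p + 1 + (q - p)"
  shows "G_lower p q $$ (r, j) =
    (if j < p then of_bool (r \<le> j) else if j \<le> 2 * p then of_nat (p - r) + of_bool (r < j - p)
     else 0)"
proof -
  have L: "L_mat p $$ (r, t) = of_nat (p - r) + of_bool (r < t)" if "t < p" for t
  proof -
    have "(K_mat p * (1\<^sub>m p + J_mat p)) $$ (r, t) = (\<Sum>i\<in>{r..<p}. of_bool (i = t) + 1)"
      using assms(1) that by (subst index_K_mult) (auto intro!: sum.cong)
    also have "\<dots> = of_bool (r \<le> t) + of_nat (p - r)"
      using that by (simp add: sum.distrib of_bool_def sum.delta')
    finally show ?thesis
      using assms(1) that unfolding L_mat_def by (auto simp: bit_add_self ac_simps)
  qed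
  have K1: "(K_mat p * const_mat p (Suc 0) 1) $$ (r, 0) = of_nat (p - r)"
    using assms(1) by (subst index_K_mult) auto
  show ?thesis
    using assms unfolding G_lower_def
    by (auto simp: index_append_rows index_append_cols index_K_mat L K1
      simp del: index_mult_mat(1))
qed

lemma index_G_lower_bottom:
  assumes "r < q - p" "j < 2 * p + 1 + (q - p)"
  shows "G_lower p q $$ (p + r, j) = of_bool (j = 2 * p + 1 + r)"
  using assms unfolding G_lower_def by (auto simp: index_append_rows index_append_cols)


section \<open>Columns of the two blocks\<close>

lemma G_mat_carrier:
  assumes "p \<le> q" "X \<in> carrier_mat p (q - p)"
  shows "G_mat p q X \<in> carrier_mat (p + q) (p + q + 1)"
  using assms by (intro carrier_matI) (simp_all add: G_mat_def)

lemma gen_c_G_mat: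
  assumes "p \<le> q" "X \<in> carrier_mat p (q - p)"
  shows "gen_c p (G_mat p q X) = G_upper p X"
  using assms by (intro eq_matI) (auto simp: gen_c_def G_mat_def index_append_rows)

lemma gen_r_G_mat:
  assumes "p \<le> q" "X \<in> carrier_mat p (q - p)"
  shows "gen_r p (G_mat p q X) = G_lower p q"
  using assms by (intro eq_matI) (auto simp: gen_r_def G_mat_def index_append_rows)

lemma col_G_lower_nonzero:
  assumes p: "3 \<le> p" and j: "j < 2 * p + 1 + (q - p)"
  shows "\<exists>r < p + (q - p). G_lower p q $$ (r, j) \<noteq> 0"
proof (cases "j \<le> 2 * p")
  case False
  then have "G_lower p q $$ (p + (j - (2 * p + 1)), j) = 1"
    using j by (subst index_G_lower_bottom) auto
  then show ?thesis
    using False j by (intro exI[of _ "p + (j - (2 * p + 1))"]) auto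
next
  case True
  have top: "G_lower p q $$ (r, j) =
      (if j < p then of_bool (r \<le> j) else of_nat (p - r) + of_bool (r < j - p))" if "r < p" for r
    using index_G_lower_top[OF that j] True by simp
  consider "j < p" | "p \<le> j" "j < 2 * p" | "j = 2 * p"
    using True by linarith
  then show ?thesis
  proof cases
    case 1
    then show ?thesis using top[of 0] p by (intro exI[of _ 0]) auto
  next
    case 2
    then have "G_lower p q $$ (p - 1, j) = 1"
      using top[of "p - 1"] p by (auto simp: Suc_diff_le)
    then show ?thesis using p by (intro exI[of _ "p - 1"]) auto
  next
    case 3
    \<comment> \<open>this column is \<open>u + 1\<^sub>p\<close>, and \<open>u\<close> is zero in the last row but one\<close>
    have "p - (p - 2) = 2" using p by simp
    then have "G_lower p q $$ (p - 2, j) = 1"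
      using top[of "p - 2"] p 3 by (simp del: of_nat_diff)
    then show ?thesis using p by (intro exI[of _ "p - 2"]) auto
  qed
qed

lemma inj_on_col_G_lower:
  assumes p: "3 \<le> p"
  shows "inj_on (col (G_lower p q)) {..<2 * p + 1 + (q - p)}"
proof -
  let ?N = "2 * p + 1 + (q - p)" and ?G = "G_lower p q"
  have False if lt: "i < j" "j < ?N" and "col ?G i = col ?G j" for i j
  proof -
    have eq: "?G $$ (r, i) = ?G $$ (r, j)" if "r < p + (q - p)" for r
      using arg_cong[OF \<open>col ?G i = col ?G j\<close>, of "\<lambda>v. v $ r"] that lt by simp
    have le: "j \<le> 2 * p"
    proof (rule ccontr)
      assume "\<not> j \<le> 2 * p"
      then obtain k where "j = 2 * p + 1 + k" "k < q - p"
        using lt(2) by (auto simp: not_le less_iff_Suc_add)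
      moreover from this have "p + k < p + (q - p)"
        by simp
      ultimately show False
        using eq[of "p + k"] lt by (simp add: index_G_lower_bottom del: add_diff_inverse_nat le_add_diff_inverse)
    qed
    have top: "?G $$ (r, k) =
        (if k < p then of_bool (r \<le> k) else of_nat (p - r) + of_bool (r < k - p))"
      if "r < p" "k \<le> j" for r k
      using index_G_lower_top[OF that(1), of k q] that(2) lt le by simp
    consider "j < p" | "p \<le> i" | "i < p" "p \<le> j"
      by linarith
    then show False
    proof cases
      case 1
      then show False using eq[of j] top[of j i] top[of j j] lt by simp
    next
      case 2
      then have "i - p < p" using lt le by simp
      then show False
        using eq[of "i - p"] top[of "i - p" i] top[of "i - p" j] lt 2 by simp
    next
      case 3
      have e: "of_bool (r \<le> i) = (of_nat (p - r) + of_bool (r < j - p) :: bit)" if "r < p" for r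
        using eq[of r] top[of r i] top[of r j] that lt 3 by (simp del: of_nat_diff)
      \<comment> \<open>the last three rows: there \<open>u\<close> reads \<open>1, 0, 1\<close>, which is not contiguous\<close>
      have "p - (p - 1) = 1" "p - (p - 2) = 2" "p - (p - 3) = 3"
        using p by auto
      then show False
        using e[of "p - 1"] e[of "p - 2"] e[of "p - 3"] p 3 le
        by (auto simp del: of_nat_diff simp: of_bool_def split: if_splits)
    qed
  qed
  then show ?thesis
    unfolding inj_on_def by (metis lessThan_iff linorder_neqE_nat)
qed

section \<open>The linear relation among the columns of the generator\<close>

text \<open>
  Dependence of \<open>S\<close> gives a vector \<open>w\<close> supported in \<open>S\<close> and annihilated by the whole matrix. The
  rows below the first \<open>2 p\<close> make \<open>w\<close> vanish beyond position \<open>2 p\<close>; row \<open>p + r\<close>, corrected by the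
  upper rows \<open>r, \<dots>, p - 1\<close>, gives \<open>w (p + r) = w (2 p)\<close>; and upper row \<open>r\<close> then gives
  \<open>w r = p w (2 p)\<close>. So \<open>w\<close> is determined by \<open>w (2 p)\<close>, which must be 1.
\<close>

lemma dependent_cols_G_mat:
  assumes pq: "p \<le> q" and X: "X \<in> carrier_mat p (q - p)"
    and S: "S \<subseteq> {..<p + q + 1}" and dep: "cols_dependent (G_mat p q X) S"
  shows "{p..2 * p} \<subseteq> S" and "odd p \<Longrightarrow> {..2 * p} \<subseteq> S"
proof -
  let ?U = "G_upper p X" and ?L = "G_lower p q"
  have [simp]: "finite S"
    using S finite_subset by blast
  obtain a where a: "\<exists>i\<in>S. a i \<noteq> 0"
    and rel: "\<And>r. r < p + q \<Longrightarrow> (\<Sum>i\<in>S. a i * G_mat p q X $$ (r, i)) = 0"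
    using dep G_mat_carrier[OF pq X] unfolding cols_dependent_def by auto
  define w where "w = (\<lambda>j. if j \<in> S then a j else 0)"
  have ext: "(\<Sum>i\<in>S. a i * f i) = (\<Sum>i<p + q + 1. w i * f i)" for f :: "nat \<Rightarrow> bit"
    unfolding w_def using S by (intro sum.mono_neutral_cong_left) auto
  have up: "(\<Sum>i<p + q + 1. w i * ?U $$ (r, i)) = 0" if "r < p" for r
    using rel[of r] that pq X unfolding ext
    by (auto simp: G_mat_def index_append_rows cong: sum.cong_simp)
  have low: "(\<Sum>i<p + q + 1. w i * ?L $$ (r, i)) = 0" if "r < q" for r
    using rel[of "p + r"] that pq X unfolding ext
    by (auto simp: G_mat_def index_append_rows cong: sum.cong_simp)
  have tail: "w j = 0" if j: "2 * p < j" "j < p + q + 1" for j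
  proof -
    define r where "r = j - (2 * p + 1)"
    have r: "r < q - p" "j = 2 * p + 1 + r"
      using j pq by (auto simp: r_def)
    have "(\<Sum>i<p + q + 1. w i * ?L $$ (p + r, i)) = (\<Sum>i<p + q + 1. if i = j then w i else 0)"
      using pq r by (intro sum.cong refl) (auto simp: index_G_lower_bottom)
    also have "\<dots> = w j"
      using j(2) by (simp del: sum.lessThan_Suc)
    finally show ?thesis
      using low[of "p + r"] r pq by simp
  qed
  have cut: "(\<Sum>i<p + q + 1. w i * f i) = (\<Sum>i\<le>2 * p. w i * f i)" for f :: "nat \<Rightarrow> bit"
    using pq tail by (intro sum.mono_neutral_right) auto
  have const: "w (p + r) = w (2 * p)" if r: "r < p" for r
  proof -
    \<comment> \<open>row \<open>r\<close> of the identity: lower block = \<open>K\<^sub>p\<close> times upper block + \<open>(0 I\<^sub>p 1\<^sub>p)\<close>\<close>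
    have split: "?L $$ (r, j) = (\<Sum>i\<in>{r..<p}. ?U $$ (i, j)) +
        (of_bool (j = p + r) + of_bool (j = 2 * p))" if j: "j \<le> 2 * p" for j
    proof (cases "j < p")
      case True
      then have "(\<Sum>i\<in>{r..<p}. ?U $$ (i, j)) = (\<Sum>i\<in>{r..<p}. if i = j then 1 else 0)"
        using j X by (intro sum.cong refl) (auto simp: index_G_upper)
      then show ?thesis
        using True r by (simp add: index_G_lower_top)
    next
      case False
      then have "(\<Sum>i\<in>{r..<p}. ?U $$ (i, j)) = (\<Sum>i\<in>{r..<p}. 1 + (if i = j - p then 1 else 0))"
        using j X by (intro sum.cong refl) (auto simp: index_G_upper bit_add_self)
      also have "\<dots> = of_nat (p - r) + of_bool (r \<le> j - p \<and> j - p < p)"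
        by (simp add: sum.distrib)
      finally show ?thesis
        using False r j
        by (auto simp: index_G_lower_top add.assoc bit_add_self simp del: of_nat_diff)
    qed
    have "0 = (\<Sum>j\<le>2 * p. w j * ?L $$ (r, j))"
      using low[of r, unfolded cut] r pq by simp
    also have "\<dots> = (\<Sum>j\<le>2 * p. (\<Sum>i\<in>{r..<p}. w j * ?U $$ (i, j)) +
        ((if j = p + r then w j else 0) + (if j = 2 * p then w j else 0)))"
    proof (intro sum.cong refl)
      fix j assume "j \<in> {..2 * p}"
      then have j: "j \<le> 2 * p"
        by simp
      have ind: "x * of_bool P = (if P then x else 0)" for x :: bit and P
        by (cases P) simp_all
      show "w j * ?L $$ (r, j) = (\<Sum>i\<in>{r..<p}. w j * ?U $$ (i, j)) +
          ((if j = p + r then w j else 0) + (if j = 2 * p then w j else 0))"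
        unfolding split[OF j] distrib_left sum_distrib_left ind ..
    qed
    also have "\<dots> = (\<Sum>i\<in>{r..<p}. \<Sum>j\<le>2 * p. w j * ?U $$ (i, j)) + (w (p + r) + w (2 * p))"
      using r by (simp add: sum.distrib sum.swap[of _ "{r..<p}"])
    also have "(\<Sum>i\<in>{r..<p}. \<Sum>j\<le>2 * p. w j * ?U $$ (i, j)) = 0"
      using up[unfolded cut] by (intro sum.neutral) auto
    finally show ?thesis
      by (simp add: bit_add_eq_0_iff)
  qed
  have mid: "w j = w (2 * p)" if "p \<le> j" "j \<le> 2 * p" for j
    using const[of "j - p"] that by (cases "j = 2 * p") auto
  have head: "w r = of_nat p * w (2 * p)" if r: "r < p" for r
  proof -
    have U: "{..2 * p} = {..<p} \<union> {p..2 * p}"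
      by auto
    have "0 = (\<Sum>j\<le>2 * p. w j * ?U $$ (r, j))"
      using up[OF r, unfolded cut] by simp
    also have "\<dots> = (\<Sum>j<p. w j * ?U $$ (r, j)) + (\<Sum>j\<in>{p..2 * p}. w j * ?U $$ (r, j))"
      unfolding U by (intro sum.union_disjoint) auto
    also have "(\<Sum>j<p. w j * ?U $$ (r, j)) = (\<Sum>j<p. if j = r then w j else 0)"
      using r X by (intro sum.cong refl) (auto simp: index_G_upper)
    also have "(\<Sum>j\<in>{p..2 * p}. w j * ?U $$ (r, j)) =
        (\<Sum>j\<in>{p..2 * p}. w (2 * p) + (if j = p + r then w (2 * p) else 0))"
    proof (intro sum.cong refl)
      fix j assume "j \<in> {p..2 * p}"
      then have j: "p \<le> j" "j \<le> 2 * p"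
        by auto
      then have "?U $$ (r, j) = 1 + of_bool (j = p + r)"
        using r X by (auto simp: index_G_upper bit_add_self)
      then show "w j * ?U $$ (r, j) = w (2 * p) + (if j = p + r then w (2 * p) else 0)"
        unfolding mid[OF j] by (simp add: distrib_left)
    qed
    also have "\<dots> = of_nat p * w (2 * p)"
      using r by (simp add: sum.distrib algebra_simps bit_add_self)
    finally show ?thesis
      using r by (simp add: bit_add_eq_0_iff)
  qed
  have one: "w (2 * p) = 1"
  proof (rule ccontr)
    assume "w (2 * p) \<noteq> 1"
    then have w0: "w (2 * p) = 0"
      by simp
    have "w j = 0" if "j < p + q + 1" for j
    proof -
      consider "j < p" | "p \<le> j" "j \<le> 2 * p" | "2 * p < j"
        by linarith
      then show ?thesis
        by cases (simp_all only: head mid tail w0 that mult_zero_right)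
    qed
    moreover obtain i where i: "i \<in> S" "a i \<noteq> 0"
      using a by blast
    moreover have "i < p + q + 1"
      using i(1) S by auto
    ultimately show False
      by (metis w_def)
  qed
  have mem: "j \<in> S" if "w j = 1" for j
    using that unfolding w_def by (auto split: if_splits)
  have upper_mem: "j \<in> S" if "p \<le> j" "j \<le> 2 * p" for j
    using mem mid[OF that] one by simp
  then show "{p..2 * p} \<subseteq> S"
    by auto
  show "{..2 * p} \<subseteq> S" if "odd p"
  proof
    fix j assume "j \<in> {..2 * p}"
    moreover have "j \<in> S" if "j < p"
      using mem head[OF that] one \<open>odd p\<close> by (simp add: of_nat_bit)
    ultimately show "j \<in> S"
      using upper_mem by (cases "j < p") auto
  qed
qed

text \<open>
  For even \<open>p\<close> the relation has \<open>p + 1\<close> terms, which is enough because \<open>p \<ge> 4\<close>. For \<open>p = 3\<close> that would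
  be only four, but then \<open>p\<close> is odd and the relation has \<open>2 p + 1\<close> terms.
\<close>

lemma small_sets_independent_G_mat:
  assumes p: "3 \<le> p" and pq: "p \<le> q" and X: "X \<in> carrier_mat p (q - p)"
    and S: "S \<subseteq> {..<p + q + 1}" "card S \<le> 4"
  shows "\<not> cols_dependent (G_mat p q X) S"
proof
  assume dep: "cols_dependent (G_mat p q X) S"
  have fin: "finite S"
    using S(1) finite_subset by blast
  show False
  proof (cases "odd p")
    case True
    from card_mono[OF fin dependent_cols_G_mat(2)[OF pq X S(1) dep True]] show False
      using S(2) p by simp
  next
    case False
    then have "4 \<le> p"
      using p by (cases "p = 3") auto
    with card_mono[OF fin dependent_cols_G_mat(1)[OF pq X S(1) dep]] show False
      using S(2) by simp
  qed
qed

lemma array_generator_G_mat: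
  assumes p: "3 \<le> p" and pq: "p \<le> q" and X: "X \<in> carrier_mat p (q - p)"
  shows "array_generator p q (p + q + 1) (G_mat p q X)"
proof -
  \<comment> \<open>the relation involves column \<open>2 p\<close>, so removing that column leaves an independent family\<close>
  let ?J = "{..<p + q + 1} - {2 * p}"
  have "\<not> cols_dependent (G_mat p q X) ?J"
  proof
    assume "cols_dependent (G_mat p q X) ?J"
    then have "{p..2 * p} \<subseteq> ?J"
      by (intro dependent_cols_G_mat(1)[OF pq X]) auto
    then have "2 * p \<in> ?J"
      by (rule subsetD) simp
    then show False by simp
  qed
  then have "card ?J \<le> vec_space.rank (p + q) (G_mat p q X)"
    by (intro vec_space.card_le_rank_if_cols_independent[OF G_mat_carrier[OF pq X]]) auto
  moreover have "card ?J = p + q"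
    using pq by simp
  ultimately have "vec_space.rank (p + q) (G_mat p q X) = p + q"
    using vec_space.rank_le_nr[OF G_mat_carrier[OF pq X]] by simp
  then show ?thesis
    using p pq G_mat_carrier[OF pq X] unfolding array_generator_def by auto
qed

section \<open>Unconfounded effects\<close>

lemma separated_if_unconfounded:
  fixes H :: "'a::field mat"
  assumes "E \<subseteq> {..<dim_col H}" "finite E" "unconfounded p H E"
  shows "inj_on (col (gen_c p H)) E"
  using not_inj_imp_cols_dependent[of E "gen_c p H"] assms
  by (auto simp: unconfounded_def confounded_with_columns_def gen_c_def)

lemma col_gen_c_nonzero:
  fixes H :: "'a::field mat"
  assumes "main_effects_unconfounded p H" "j < dim_col H"
  shows "col (gen_c p H) j \<noteq> 0\<^sub>v p"
proof -
  have "unconfounded p H {j}"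
    using assms unfolding main_effects_unconfounded_def main_effects_def by auto
  then show ?thesis
    using zero_col_imp_cols_dependent[of j "gen_c p H"] assms(2)
    by (auto simp: unconfounded_def confounded_with_columns_def gen_c_def)
qed

lemma col_G_upper_nonzero:
  assumes p: "2 \<le> p" and X: "X \<in> carrier_mat p k" "\<And>j. j < k \<Longrightarrow> col X j \<noteq> 0\<^sub>v p"
    and j: "j < 2 * p + 1 + k"
  shows "col (G_upper p X) j \<noteq> 0\<^sub>v p"
proof
  assume eq: "col (G_upper p X) j = 0\<^sub>v p"
  have zero: "G_upper p X $$ (r, j) = 0" if "r < p" for r
    using arg_cong[OF eq, of "\<lambda>v. v $ r"] that j X(1) by simp
  consider "j < p" | "p \<le> j" "j \<le> 2 * p" | "2 * p < j"
    by linarith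
  then show False
  proof cases
    case 1
    then show False
      using zero[of j] index_G_upper[OF X(1) 1 j] by simp
  next
    case 2
    define r where "r = (if j = p then 1 else 0 :: nat)"
    have "r < p"
      using p by (simp add: r_def)
    then show False
      using zero[of r] index_G_upper[OF X(1) _ j, of r] 2 by (auto simp: r_def split: if_splits)
  next
    case 3
    have "X $$ (r, j - (2 * p + 1)) = 0" if "r < p" for r
      using zero[OF that] index_G_upper[OF X(1) that j] 3 by simp
    then have "col X (j - (2 * p + 1)) = 0\<^sub>v p"
      using X(1) j 3 by (intro eq_vecI) auto
    moreover have "j - (2 * p + 1) < k"
      using 3 j by simp
    ultimately show False
      using X(2) by simp
  qed
qed

text \<open>
  For the constructed generator the necessary condition of the upper bound is also sufficient: the
  only possible confounding is that of a two-factor interaction with column effects, caused by equal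
  upper columns.
\<close>

lemma unconfounded_G_mat:
  assumes p: "3 \<le> p" and pq: "p \<le> q" and X: "X \<in> carrier_mat p (q - p)"
    and X0: "\<And>j. j < q - p \<Longrightarrow> col X j \<noteq> 0\<^sub>v p"
    and E: "E \<in> main_effects (p + q + 1) \<union> two_factor_interactions (p + q + 1)"
    and inj: "inj_on (col (G_upper p X)) E"
  shows "unconfounded p (G_mat p q X) E"
proof -
  let ?n = "p + q + 1"
  have small: "E' \<subseteq> {..<?n} \<and> card E' \<le> 2"
    if "E' \<in> main_effects ?n \<union> two_factor_interactions ?n" for E'
    using that unfolding main_effects_def two_factor_interactions_def by auto
  have "\<not> confounded_effects (G_mat p q X) E E'"
    if "E' \<in> main_effects ?n \<union> two_factor_interactions ?n" for E'
  proof -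
    have "card (E \<union> E') \<le> 4"
      using card_Un_le[of E E'] small[OF E] small[OF that] by linarith
    then show ?thesis
      unfolding confounded_effects_def
      using small_sets_independent_G_mat[OF p pq X] small[OF E] small[OF that] by simp
  qed
  moreover obtain i j where ij: "E = {i, j}" "i < ?n" "j < ?n"
    using E unfolding main_effects_def two_factor_interactions_def
    by (auto simp: insert_absorb2)
  have upper_nz: "col (G_upper p X) k \<noteq> 0\<^sub>v p" if k: "k < ?n" for k
    using col_G_upper_nonzero[OF _ X X0] p pq k by simp
  have "\<not> cols_dependent (G_upper p X) E"
    using dependent_pair_bit[of "G_upper p X" i j] upper_nz ij inj pq X by auto
  moreover have lower_nz: "col (G_lower p q) k \<noteq> 0\<^sub>v (p + (q - p))" if k: "k < ?n" for k
  proof -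
    obtain r where "r < p + (q - p)" "G_lower p q $$ (r, k) \<noteq> 0"
      using col_G_lower_nonzero[OF p, of k q] k pq by auto
    then show ?thesis
      using k pq by (auto dest!: arg_cong[of _ _ "\<lambda>v. v $ r"])
  qed
  have "\<not> cols_dependent (G_lower p q) E"
    using dependent_pair_bit[of "G_lower p q" i j] lower_nz ij inj_on_col_G_lower[OF p, of q] pq
    by (auto simp: inj_on_def)
  ultimately show ?thesis
    using G_mat_carrier[OF pq X]
    by (auto simp: unconfounded_def confounded_with_columns_def confounded_with_rows_def
        gen_c_G_mat[OF pq X] gen_r_G_mat[OF pq X])
qed


section \<open>Optimality\<close>

lemma appearances_point_bit:
  fixes A :: "bit mat"
  assumes "v \<in> carrier_vec (dim_row A)" "v \<noteq> 0\<^sub>v (dim_row A)"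
  shows "appearances A (range (\<lambda>a. a \<cdot>\<^sub>v v)) = card {j. j < dim_col A \<and> col A j = v}"
proof -
  have "w \<in> range (\<lambda>a. a \<cdot>\<^sub>v v) \<longleftrightarrow> w = 0\<^sub>v (dim_row A) \<or> w = v" for w
  proof -
    have v01: "0 \<cdot>\<^sub>v v = 0\<^sub>v (dim_row A)" "1 \<cdot>\<^sub>v v = v"
      using assms(1) by auto
    show ?thesis
    proof
      assume "w \<in> range (\<lambda>a. a \<cdot>\<^sub>v v)"
      then obtain a where "w = a \<cdot>\<^sub>v v" by blast
      then show "w = 0\<^sub>v (dim_row A) \<or> w = v"
        using v01 by (cases a) auto
    next
      assume "w = 0\<^sub>v (dim_row A) \<or> w = v"
      then show "w \<in> range (\<lambda>a. a \<cdot>\<^sub>v v)"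
        using v01 by (metis rangeI)
    qed
  qed
  then show ?thesis
    unfolding appearances_def using assms(2) by (intro arg_cong[of _ _ card]) auto
qed

theorem theorem8:
  fixes p q n \<alpha> :: nat and X :: "bit mat"
  assumes "3 \<le> p" and "p \<le> q" and "n = p + q + 1"
    and "\<alpha> = n div (2 ^ p - 1)"
    and "X \<in> carrier_mat p (q - p)"
    and "\<And>j. j < q - p \<Longrightarrow> col X j \<noteq> 0\<^sub>v p"
    and "\<And>P. P \<in> PG_points p \<Longrightarrow> appearances (G_upper p X) P \<in> {\<alpha>, \<alpha> + 1}"
  shows "fractional_factorial_generator p q n 1 (G_mat p q X) \<and>
    two_fi_optimal p q n (G_mat p q X)"
proof -
  note p = assms(1) and pq = assms(2) and n = assms(3) and X = assms(5) and X0 = assms(6)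
    and balanced = assms(7)
  let ?G = "G_mat p q X" and ?U = "G_upper p X"
  let ?sep = "\<lambda>f :: nat \<Rightarrow> bit vec. {E \<in> two_factor_interactions n. inj_on f E}"
  have gen: "array_generator p q n ?G"
    unfolding n by (rule array_generator_G_mat[OF p pq X])
  have dimG: "dim_col ?G = n"
    using G_mat_carrier[OF pq X] n by simp
  have dimU: "dim_row ?U = p" "dim_col ?U = n"
    using X n pq by simp_all
  have main: "main_effects_unconfounded p ?G"
    unfolding main_effects_unconfounded_def dimG n
    by (intro ballI unconfounded_G_mat[OF p pq X X0]) (auto simp: main_effects_def)
  have fin: "finite (two_factor_interactions n)"
    by (rule finite_subset[of _ "Pow {..<n}"]) (auto simp: two_factor_interactions_def)
  have numG: "card (?sep (col ?U)) \<le> num_unconfounded_2fi p ?G"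
    unfolding num_unconfounded_2fi_def dimG n
    by (intro card_mono) (use fin unconfounded_G_mat[OF p pq X X0] n in auto)
  have "num_unconfounded_2fi p H \<le> num_unconfounded_2fi p ?G"
    if H: "array_generator p q n H" "main_effects_unconfounded p H" for H :: "bit mat"
  proof -
    have dimH: "dim_col H = n"
      using H(1) unfolding array_generator_def by auto
    let ?f = "col (gen_c p H)" and ?g = "col ?U"
    \<comment> \<open>one common index set, so that the class sizes of both matrices add up to \<open>n\<close> over it\<close>
    define V where "V = ?f ` {..<n} \<union> ?g ` {..<n}"
    define m where "m = (\<lambda>(h :: nat \<Rightarrow> bit vec) v. card {j. j < n \<and> h j = v})"
    have V: "finite V" "?f ` {..<n} \<subseteq> V" "?g ` {..<n} \<subseteq> V"
      by (auto simp: V_def)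
    have V_nz: "v \<in> carrier_vec p \<and> v \<noteq> 0\<^sub>v p" if "v \<in> V" for v
    proof -
      have "?f j \<in> carrier_vec p \<and> ?f j \<noteq> 0\<^sub>v p" if "j < n" for j
        using col_gen_c_nonzero[OF H(2), of j] that dimH
        by (auto intro!: carrier_vecI simp: gen_c_def)
      moreover have "?g j \<in> carrier_vec p \<and> ?g j \<noteq> 0\<^sub>v p" if "j < n" for j
        using col_G_upper_nonzero[OF _ X X0, of j] that n p pq X by (auto intro!: carrier_vecI)
      ultimately show ?thesis
        using that by (auto simp: V_def)
    qed
    have total: "sum (m h) V = n" if "h ` {..<n} \<subseteq> V" for h
    proof -
      have "{..<n} = (\<Union>v\<in>V. {j. j < n \<and> h j = v})"
        using that by auto
      then have "n = card (\<Union>v\<in>V. {j. j < n \<and> h j = v})"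
        by (metis card_lessThan)
      also have "\<dots> = sum (m h) V"
        unfolding m_def by (rule card_UN_disjoint) (use V in auto)
      finally show ?thesis by simp
    qed
    have bal: "m ?g v \<in> {\<alpha>, \<alpha> + 1}" if "v \<in> V" for v
    proof -
      have "range (\<lambda>a. a \<cdot>\<^sub>v v) \<in> PG_points p"
        using V_nz[OF that] unfolding PG_points_def by blast
      from balanced[OF this] show ?thesis
        using appearances_point_bit[of v ?U] V_nz[OF that] dimU by (simp add: m_def)
    qed
    have "(\<Sum>v\<in>V. (m ?g v)\<^sup>2) \<le> (\<Sum>v\<in>V. (m ?f v)\<^sup>2)"
      using balanced_sum_squares_le[of "m ?f" V "m ?g", OF _ bal] total[OF V(2)] total[OF V(3)]
      by simp
    then have "card (?sep ?f) \<le> card (?sep ?g)"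
      using card_separated_2fi[OF V(1,2)] card_separated_2fi[OF V(1,3)] unfolding m_def by linarith
    moreover have "num_unconfounded_2fi p H \<le> card (?sep ?f)"
      unfolding num_unconfounded_2fi_def dimH
    proof (rule card_mono)
      show "{E \<in> two_factor_interactions n. unconfounded p H E} \<subseteq> ?sep ?f"
      proof (intro subsetI CollectI conjI; elim CollectE conjE)
        fix E assume E: "E \<in> two_factor_interactions n" "unconfounded p H E"
        then have "E \<subseteq> {..<dim_col H}" "finite E"
          using dimH by (auto simp: two_factor_interactions_def)
        then show "inj_on ?f E"
          using E(2) by (rule separated_if_unconfounded)
      qed
    qed (use fin in auto)
    ultimately show ?thesis
      using numG by linarith
  qed
  then show ?thesis
    using gen main n unfolding fractional_factorial_generator_def two_fi_optimal_def by auto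
qed

end
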